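(* Let $\bar P_1,\bar P_2,\ldots$ be Bayesian predictive distributions with densities $\bar p_1,\bar p_2,\ldots$. Let $P_{\rm sw}$ be the switch distribution for $\bar P_1,\bar P_2,\ldots$ with prior $\pi$ of the product form $\pi(\mathbf s)=\pi_{\rm M}(m)\,\pi_{\rm K}(k_1)\prod_{i=2}^m\pi_{\rm T}(t_i\mid t_i>t_{i-1})\,\pi_{\rm K}(k_i)$. Let $P_{\rm bma}$ be the Bayesian model averaging distribution for the same estimators, defined with respect to the same prior $\pi_{\rm K}$ on the estimators, i.e. $p_{\rm bma}(x^n)=\sum_{k\in\mathbb Z^+}\pi_{\rm K}(k)\bar p_k(x^n)$. Then, for all $n\in\mathbb Z^+$, all $x^n\in\mathcal X^n$, and all $k\in\mathbb Z^+$, $$p_{\rm sw}(x^n)\ \ge\ \pi_{\rm M}(1)\,p_{\rm bma}(x^n)\ \ge\ \pi_{\rm M}(1)\,\pi_{\rm K}(k)\,\bar p_k(x^n).$$ Consequently, if $X_1,X_2,\ldots$ are distributed according to any distribution $P^*$, then for any $k\in\mathbb Z^+$ (and every $n\in\mathbb Z^+$), $$\sum_{i=1}^n r_i(P^*,P_{\rm sw})\ \le\ \sum_{i=1}^n r_i(P^*,P_{\rm bma})-\log\pi_{\rm M}(1)\ \le\ \sum_{i=1}^n r_i(P^*,\bar P_k)-\log\pi_{\rm M}(1)-\log\pi_{\rm K}(k).$$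
   Context: $X^\infty=(X_1,X_2,\ldots)$ takes values in $\mathcal{X}^\infty$, $\mathcal{X}\subseteq\mathbb{R}^d$; densities are relative to Lebesgue or counting measure; logarithms are base 2; $\mathbb N=\{0,1,\dots\}$, $\mathbb Z^+=\{1,2,\dots\}$. A prediction strategy (estimator) $p$ assigns to each $n\in\mathbb N$, $x^n\in\mathcal X^n$ a density $p(X_{n+1}\mid x^n)$ with distribution $P(X_{n+1}\mid x^n)$, measurable in $x^n$; $p(x^n)=\prod_{i=1}^np(x_i\mid x^{i-1})$. The Bayesian predictive distribution of a model $\{p_\theta:\theta\in\Theta_k\}$ with prior density $w_k$ is the prediction strategy with joint density $\bar p_k(x^n)=\int_{\Theta_k}p_\theta(x^n)w_k(\theta)\,d\theta$. Switch distribution: $\mathbb{S}=\{((t_1,k_1),\ldots,(t_m,k_m))\in(\mathbb N\times\mathbb Z^+)^m\mid m\in\mathbb Z^+,\ 0=t_1<\cdots<t_m\}$. For $\mathbf s\in\mathbb S$, $q_{\mathbf s}$ is the prediction strategy that predicts $X_{n+1}$ given $x^n$ by $\bar p_{k_i}(X_{n+1}\mid x^n)$, where $i$ is the unique index with $t_i\le n$ and ($i=m$ or $t_{i+1}>n$). The switch distribution $P_{\rm sw}$ with prior $\pi$ (a mass function on $\mathbb S$) has density $p_{\rm sw}(x^n)=\sum_{\mathbf s\in\mathbb S}q_{\mathbf s}(x^n)\pi(\mathbf s)$. In the product form of the prior, $\pi_{\rm M},\pi_{\rm K},\pi_{\rm T}$ are probability mass functions on $\mathbb Z^+$ with full support,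 and $\pi_{\rm T}(t\mid t>t')=\pi_{\rm T}(t)/\sum_{u>t'}\pi_{\rm T}(u)$ for $t>t'$. Risk: $r_n(P^*,\bar P)=E_{X^{n-1}\sim P^*}\big[D\big(P^*(X_n=\cdot\mid X^{n-1})\,\|\,\bar P(X_n=\cdot\mid X^{n-1})\big)\big]\in[0,\infty]$, with $D(P\|Q)=E_P[\log(p(Y)/q(Y))]$ the Kullback–Leibler divergence. It is assumed throughout that under $P^*$ the conditional distributions $P^*(X_n\mid X^{n-1})$ have densities with $P^*$-probability one. *)

theory Defs
  imports "HOL-Probability.Probability"
begin

text \<open>
  Sample sequences are functions \<open>nat \<Rightarrow> 'a\<close> with zero-based indices: \<open>x i\<close> is the outcome usually
  written \<open>x\<^sub>i\<^sub>+\<^sub>1\<close>. A history \<open>x\<^sup>n\<close> is an element of \<open>{..<n} \<rightarrow>\<^sub>E X\<close>.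
\<close>

definition base_measure :: "'a::euclidean_space set \<Rightarrow> 'a measure \<Rightarrow> bool" where
  "base_measure X \<mu> \<longleftrightarrow>
     X \<in> sets borel \<and> \<mu> = restrict_space lborel X \<or> countable X \<and> \<mu> = count_space X"

abbreviation history_space :: "'a measure \<Rightarrow> nat \<Rightarrow> (nat \<Rightarrow> 'a) measure" where
  "history_space \<mu> n \<equiv> PiM {..<n} (\<lambda>_. \<mu>)"

text \<open>\<open>p n x y\<close> is the density \<open>p(X\<^sub>n\<^sub>+\<^sub>1 = y | x\<^sup>n)\<close>.\<close>

type_synonym 'a strategy = "nat \<Rightarrow> (nat \<Rightarrow> 'a) \<Rightarrow> 'a \<Rightarrow> ennreal"

text \<open>
  Measurability is joint in history and outcome. Separate measurability would not make the product
  \<open>p(x\<^sup>n)\<close> a measurable function, hence not a density.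
\<close>

definition prediction_strategy :: "'a measure \<Rightarrow> 'a strategy \<Rightarrow> bool" where
  "prediction_strategy \<mu> p \<longleftrightarrow>
     (\<forall>n. (\<lambda>(x, y). p n x y) \<in> borel_measurable (history_space \<mu> n \<Otimes>\<^sub>M \<mu>) \<and>
          (\<forall>x\<in>space (history_space \<mu> n). (\<integral>\<^sup>+ y. p n x y \<partial>\<mu>) = 1))"

definition joint :: "'a strategy \<Rightarrow> nat \<Rightarrow> (nat \<Rightarrow> 'a) \<Rightarrow> ennreal" where
  "joint p n x = (\<Prod>i<n. p i (restrict x {..<i}) (x i))"

text \<open>
  A density is determined only almost everywhere, and a mixture of densities may be infinite on a
  null set. So a strategy is said to have joint density \<open>f\<close> if its joint density agrees with \<open>f\<close>
  almost everywhere; for counting measure this is agreement everywhere.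
\<close>

definition has_joint_density ::
    "'a measure \<Rightarrow> 'a strategy \<Rightarrow> (nat \<Rightarrow> (nat \<Rightarrow> 'a) \<Rightarrow> ennreal) \<Rightarrow> bool" where
  "has_joint_density \<mu> p f \<longleftrightarrow>
     prediction_strategy \<mu> p \<and> (\<forall>n. AE x in history_space \<mu> n. joint p n x = f n x)"

text \<open>
  The parameter set \<open>\<Theta>\<close> is \<open>space \<nu>\<close>, and \<open>\<nu>\<close> is the reference measure \<open>d\<theta>\<close> of the prior density \<open>w\<close>.
\<close>

definition bayesian_predictive ::
    "'a measure \<Rightarrow> 'c measure \<Rightarrow> ('c \<Rightarrow> ennreal) \<Rightarrow> ('c \<Rightarrow> 'a strategy) \<Rightarrow> 'a strategy \<Rightarrow> bool" where
  "bayesian_predictive \<mu> \<nu> w P p \<longleftrightarrow>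
     w \<in> borel_measurable \<nu> \<and> (\<integral>\<^sup>+ \<theta>. w \<theta> \<partial>\<nu>) = 1 \<and>
     (\<forall>\<theta>\<in>space \<nu>. prediction_strategy \<mu> (P \<theta>)) \<and>
     (\<forall>n. (\<lambda>(\<theta>, x). joint (P \<theta>) n x) \<in> borel_measurable (\<nu> \<Otimes>\<^sub>M history_space \<mu> n)) \<and>
     has_joint_density \<mu> p (\<lambda>n x. \<integral>\<^sup>+ \<theta>. joint (P \<theta>) n x * w \<theta> \<partial>\<nu>)"

definition switch_seqs :: "(nat \<times> nat) list set" where
  "switch_seqs = {s. s \<noteq> [] \<and> fst (s ! 0) = 0 \<and> sorted_wrt (<) (map fst s) \<and>
                     (\<forall>(t, k)\<in>set s. 1 \<le> k)}"

definition active_index :: "(nat \<times> nat) list \<Rightarrow> nat \<Rightarrow> nat" where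
  "active_index s n =
     (THE i. i < length s \<and> fst (s ! i) \<le> n \<and> (i + 1 = length s \<or> fst (s ! (i + 1)) > n))"

definition switch_strategy :: "(nat \<Rightarrow> 'a strategy) \<Rightarrow> (nat \<times> nat) list \<Rightarrow> 'a strategy" where
  "switch_strategy pb s n = pb (snd (s ! active_index s n)) n"

definition switch_prior :: "nat pmf \<Rightarrow> nat pmf \<Rightarrow> nat pmf \<Rightarrow> (nat \<times> nat) list \<Rightarrow> real" where
  "switch_prior \<pi>M \<pi>K \<pi>T s =
     pmf \<pi>M (length s) * pmf \<pi>K (snd (s ! 0)) *
     (\<Prod>i=1..<length s. pmf \<pi>T (fst (s ! i)) / measure_pmf.prob \<pi>T {fst (s ! (i - 1))<..}
                        * pmf \<pi>K (snd (s ! i)))"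

definition switch_density ::
    "((nat \<times> nat) list \<Rightarrow> real) \<Rightarrow> (nat \<Rightarrow> 'a strategy) \<Rightarrow> nat \<Rightarrow> (nat \<Rightarrow> 'a) \<Rightarrow> ennreal" where
  "switch_density \<pi> pb n x =
     (\<Sum>\<^sub>\<infinity>s\<in>switch_seqs. joint (switch_strategy pb s) n x * ennreal (\<pi> s))"

definition bma_density ::
    "nat pmf \<Rightarrow> (nat \<Rightarrow> 'a strategy) \<Rightarrow> nat \<Rightarrow> (nat \<Rightarrow> 'a) \<Rightarrow> ennreal" where
  "bma_density \<pi>K pb n x = (\<Sum>\<^sub>\<infinity>k\<in>{1..}. ennreal (pmf \<pi>K k) * joint (pb k) n x)"

definition log2_ennreal :: "ennreal \<Rightarrow> ereal" where
  "log2_ennreal r = (if r = 0 then -\<infinity> else if r = \<infinity> then \<infinity> else ereal (log 2 (enn2real r)))"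

text \<open>\<open>e2ennreal\<close> maps negative values to \<open>0\<close>, so it takes positive parts.\<close>

definition ext_expectation :: "'a measure \<Rightarrow> ('a \<Rightarrow> ereal) \<Rightarrow> ereal" where
  "ext_expectation P f =
     enn2ereal (\<integral>\<^sup>+ y. e2ennreal (f y) \<partial>P) - enn2ereal (\<integral>\<^sup>+ y. e2ennreal (- f y) \<partial>P)"

text \<open>
  \<open>P\<close> and \<open>Q\<close> are required to have densities with respect to \<open>\<mu>\<close>. Where the density of \<open>Q\<close> is \<open>0\<close> and
  that of \<open>P\<close> is not, the ratio in \<open>ennreal\<close> is \<open>\<infinity>\<close>. In contrast to the real-valued
  \<open>KL_divergence\<close>, an infinite divergence has the value \<open>\<infinity>\<close> here.
\<close>

definition kl_div :: "'a measure \<Rightarrow> 'a measure \<Rightarrow> 'a measure \<Rightarrow> ereal" where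
  "kl_div \<mu> P Q = ext_expectation P (\<lambda>y. log2_ennreal (RN_deriv \<mu> P y / RN_deriv \<mu> Q y))"

text \<open>\<open>\<kappa> n\<close> is a regular conditional distribution of \<open>X\<^sub>n\<^sub>+\<^sub>1\<close> given \<open>X\<^sup>n\<close> under \<open>R\<close>.\<close>

definition cond_distrs ::
    "'a measure \<Rightarrow> (nat \<Rightarrow> 'a) measure \<Rightarrow> (nat \<Rightarrow> (nat \<Rightarrow> 'a) \<Rightarrow> 'a measure) \<Rightarrow> bool" where
  "cond_distrs \<mu> R \<kappa> \<longleftrightarrow>
     (\<forall>n. \<kappa> n \<in> history_space \<mu> n \<rightarrow>\<^sub>M prob_algebra \<mu> \<and>
          (\<forall>A\<in>sets (history_space \<mu> n). \<forall>B\<in>sets \<mu>.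
             emeasure R {\<omega>\<in>space R. restrict \<omega> {..<n} \<in> A \<and> \<omega> n \<in> B} =
             (\<integral>\<^sup>+ \<omega>. indicator A (restrict \<omega> {..<n}) * emeasure (\<kappa> n (restrict \<omega> {..<n})) B \<partial>R)))"

text \<open>
  A law of \<open>X\<^sup>\<infinity>\<close> together with its conditional distributions, which have densities almost surely.
\<close>

definition data_law ::
    "'a measure \<Rightarrow> (nat \<Rightarrow> 'a) measure \<Rightarrow> (nat \<Rightarrow> (nat \<Rightarrow> 'a) \<Rightarrow> 'a measure) \<Rightarrow> bool" where
  "data_law \<mu> R \<kappa> \<longleftrightarrow>
     prob_space R \<and> sets R = sets (PiM UNIV (\<lambda>_. \<mu>)) \<and> cond_distrs \<mu> R \<kappa> \<and>
     (\<forall>n. AE \<omega> in R. \<exists>f\<in>borel_measurable \<mu>. \<kappa> n (restrict \<omega> {..<n}) = density \<mu> f)"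

text \<open>The risk of predicting the \<open>n\<close>-th outcome, counted from \<open>n = 1\<close>, given the \<open>n - 1\<close> before it.\<close>

definition risk ::
    "'a measure \<Rightarrow> (nat \<Rightarrow> 'a) measure \<Rightarrow> (nat \<Rightarrow> (nat \<Rightarrow> 'a) \<Rightarrow> 'a measure) \<Rightarrow>
     'a strategy \<Rightarrow> nat \<Rightarrow> ereal" where
  "risk \<mu> R \<kappa> p n =
     ext_expectation R (\<lambda>\<omega>. let x = restrict \<omega> {..<n - 1} in
       kl_div \<mu> (\<kappa> (n - 1) x) (density \<mu> (p (n - 1) x)))"

end

theory Submission
  imports Defs
begin

text \<open>
  The first chain of inequalities compares sums of nonnegative terms. A switch sequence
  \<open>[(0, k)]\<close> never switches, so its strategy is \<open>pb k\<close>, and its prior mass is \<open>\<pi>M(1) \<pi>K(k)\<close>; these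
  sequences alone contribute \<open>\<pi>M(1)\<close> times the Bayesian average to the switch density. In the same
  way, the average contains the term of each single \<open>k\<close>.

  The second chain is the statement that a strategy whose joint density dominates \<open>c\<close> times that of
  another one loses at most \<open>- log c\<close> against it in summed risk (\<open>sum_risk_le\<close>). By the chain rule,
  the summed risk is the expectation of \<open>log (f(X\<^sup>n) / p(X\<^sup>n))\<close>, where \<open>f\<close> is the density of the
  data. So a strategy enters only through its joint density, and a domination of joint densities by
  the factor \<open>c\<close> becomes the additive term \<open>- log c\<close>. Three points need care.

  \<^item> Divergences may be infinite and log-ratios may change sign. The negative part of a log-ratio
    always has expectation at most \<open>1 / ln 2\<close>, because \<open>ln u \<le> u\<close> and densities integrate to one
    (\<open>kernel_integral_neg_log2_le\<close>). So positive and negative parts can be integrated and summed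
    separately as extended nonnegative numbers, and no case of infinite risk has to be set apart
    (\<open>risk_eq_expected_log_ratio\<close>, \<open>sum_log_ratio_le\<close>).

  \<^item> The conditional distributions have densities for almost every past, but a choice past by past
    need not be jointly measurable in past and outcome. A jointly measurable version is the
    Radon-Nikodym derivative of the joint law of past and outcome with respect to the law of the
    past times \<open>\<mu>\<close>; it is the right one for almost all pasts simultaneously because the
    \<open>\<sigma>\<close>-algebra of the outcomes is countably generated (\<open>conditional_density\<close>).

  \<^item> Joint densities are known only up to null sets of the product base measure. These are null
    sets of the data law as well, by induction on the length of the history
    (\<open>AE_history_null_set\<close>).
\<close>

section \<open>Density bounds\<close>

lemma ennreal_cmult_infsum:
  fixes f :: "'b \<Rightarrow> ennreal"
  assumes "c < \<infinity>"
  shows "c * (\<Sum>\<^sub>\<infinity>x\<in>A. f x) = (\<Sum>\<^sub>\<infinity>x\<in>A. c * f x)"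
proof -
  have "(f has_sum (\<Sum>\<^sub>\<infinity>x\<in>A. f x)) A"
    by (simp add: nonneg_summable_on_complete)
  then have "((\<lambda>x. c * f x) has_sum (c * (\<Sum>\<^sub>\<infinity>x\<in>A. f x))) A"
    using assms ennreal_tendsto_cmult[of c "sum f"] unfolding has_sum_def
    by (simp add: sum_distrib_left)
  then show ?thesis by (rule infsumI[symmetric])
qed

lemma infsum_mono_subset_ennreal:
  fixes f g :: "'b \<Rightarrow> ennreal"
  assumes "A \<subseteq> B" "\<And>x. x \<in> A \<Longrightarrow> f x \<le> g x"
  shows "infsum f A \<le> infsum g B"
  using assms by (intro infsum_mono_neutral) (auto intro!: nonneg_summable_on_complete)

lemma active_index_singleton: "active_index [(0, k)] n = 0"
  unfolding active_index_def by (rule the_equality) auto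

lemma switch_strategy_singleton: "switch_strategy pb [(0, k)] = pb k"
  by (rule ext) (simp add: switch_strategy_def active_index_singleton)

lemma switch_prior_singleton: "switch_prior \<pi>M \<pi>K \<pi>T [(0, k)] = pmf \<pi>M 1 * pmf \<pi>K k"
  by (simp add: switch_prior_def)

text \<open>
  All summands are nonnegative, so the sum may be restricted to the sequences \<open>[(0, k)]\<close>.
\<close>

lemma switch_density_ge_bma:
  "ennreal (pmf \<pi>M 1) * bma_density \<pi>K pb n x \<le> switch_density (switch_prior \<pi>M \<pi>K \<pi>T) pb n x"
proof -
  let ?h = "\<lambda>k::nat. [(0::nat, k)]"
  have "ennreal (pmf \<pi>M 1) * bma_density \<pi>K pb n x =
      (\<Sum>\<^sub>\<infinity>k\<in>{1..}. ennreal (pmf \<pi>M 1) * (ennreal (pmf \<pi>K k) * joint (pb k) n x))"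
    unfolding bma_density_def by (rule ennreal_cmult_infsum) simp
  also have "\<dots> = (\<Sum>\<^sub>\<infinity>k\<in>{1..}. joint (switch_strategy pb (?h k)) n x *
      ennreal (switch_prior \<pi>M \<pi>K \<pi>T (?h k)))"
    by (simp add: switch_strategy_singleton switch_prior_singleton ennreal_mult' mult_ac)
  also have "\<dots> = (\<Sum>\<^sub>\<infinity>s\<in>?h ` {1..}. joint (switch_strategy pb s) n x *
      ennreal (switch_prior \<pi>M \<pi>K \<pi>T s))"
    by (subst infsum_reindex) (auto simp: inj_on_def o_def)
  also have "\<dots> \<le> switch_density (switch_prior \<pi>M \<pi>K \<pi>T) pb n x"
    unfolding switch_density_def
    by (rule infsum_mono_subset_ennreal) (auto simp: switch_seqs_def)
  finally show ?thesis .
qed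

lemma bma_density_ge_component:
  assumes "1 \<le> k"
  shows "ennreal (pmf \<pi>K k) * joint (pb k) n x \<le> bma_density \<pi>K pb n x"
proof -
  have "ennreal (pmf \<pi>K k) * joint (pb k) n x =
      (\<Sum>\<^sub>\<infinity>j\<in>{k}. ennreal (pmf \<pi>K j) * joint (pb j) n x)" by simp
  also have "\<dots> \<le> bma_density \<pi>K pb n x"
    unfolding bma_density_def using assms by (intro infsum_mono_subset_ennreal) auto
  finally show ?thesis .
qed

section \<open>Extended logarithms and expectations\<close>

text \<open>
  Positive and negative parts of the binary logarithm. Kept apart, they can be integrated and added
  as extended nonnegative numbers, where no \<open>\<infinity> - \<infinity>\<close> arises.
\<close>

definition pos_log2 :: "ennreal \<Rightarrow> ennreal" where "pos_log2 r = e2ennreal (log2_ennreal r)"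
definition neg_log2 :: "ennreal \<Rightarrow> ennreal" where "neg_log2 r = e2ennreal (- log2_ennreal r)"

lemma log2_ennreal_measurable [measurable]: "log2_ennreal \<in> borel_measurable borel"
  unfolding log2_ennreal_def by measurable
lemma pos_log2_measurable [measurable]: "pos_log2 \<in> borel_measurable borel"
  unfolding pos_log2_def by measurable
lemma neg_log2_measurable [measurable]: "neg_log2 \<in> borel_measurable borel"
  unfolding neg_log2_def by measurable

lemma pos_log2_ennreal: "0 < r \<Longrightarrow> pos_log2 (ennreal r) = ennreal (log 2 r)"
  by (simp add: pos_log2_def log2_ennreal_def)
lemma neg_log2_ennreal: "0 < r \<Longrightarrow> neg_log2 (ennreal r) = ennreal (- log 2 r)"
  by (simp add: neg_log2_def log2_ennreal_def)
lemma pos_log2_top: "pos_log2 top = top"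
  by (simp add: pos_log2_def log2_ennreal_def e2ennreal_infty)

text \<open>
  This is \<open>ln u \<le> u\<close> for \<open>u = 1 / r\<close>. It will bound the expected negative part of a log-ratio, since the
  inverse of a likelihood ratio has expectation at most one.
\<close>

lemma neg_log2_le_inverse: "neg_log2 r \<le> ennreal (1 / ln 2) * inverse r"
proof (cases r)
  case (real x)
  show ?thesis
  proof (cases "x = 0")
    case True then show ?thesis using real by (simp add: ennreal_mult_top)
  next
    case False
    then have x: "0 < x" using real by simp
    have "- log 2 x = ln (inverse x) / ln 2" using x by (simp add: log_def ln_inverse)
    also have "\<dots> \<le> inverse x / ln 2"
      using ln_le_minus_one[of "inverse x"] x by (intro divide_right_mono) auto
    finally show ?thesis using x real
      by (simp add: neg_log2_ennreal inverse_ennreal ennreal_mult'[symmetric] field_simps)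
  qed
next
  case top then show ?thesis by (simp add: neg_log2_def log2_ennreal_def e2ennreal_neg)
qed

text \<open>
  For positive finite \<open>a\<close> both sides are equal. For \<open>a = 0\<close> the left side is \<open>0\<close>, and for \<open>a = \<infinity>\<close> it is
  \<open>0\<close> or \<open>b = \<infinity>\<close>.
\<close>

lemma ennreal_mult_inverse_divide_le: "a * inverse (a / b) \<le> b" for a b :: ennreal
proof (cases a; cases b)
  fix x y :: real
  assume a: "0 \<le> x" "a = ennreal x" and b: "0 \<le> y" "b = ennreal y"
  consider "x = 0" | "0 < x" "y = 0" | "0 < x" "0 < y" using a b by linarith
  then show ?thesis
  proof cases
    case 3
    then have "a * inverse (a / b) = ennreal x * ennreal (inverse (x / y))"
      using a b by (simp add: divide_ennreal inverse_ennreal)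
    also have "\<dots> = ennreal (x * inverse (x / y))"
      using a(1) by (rule ennreal_mult'[symmetric])
    also have "x * inverse (x / y) = y" using 3 by simp
    finally show ?thesis using b by simp
  qed (use a b in \<open>auto simp: ennreal_divide_zero\<close>)
qed (auto simp: ennreal_top_divide)

lemma e2ennreal_max_0: "e2ennreal (max 0 x) = e2ennreal x"
  by (cases "0 \<le> x") (auto simp: max_def e2ennreal_neg)

lemma e2ennreal_diff: "e2ennreal (enn2ereal a - enn2ereal b) = a - b"
  unfolding e2ennreal_max_0[of "enn2ereal a - enn2ereal b", symmetric] minus_ennreal.rep_eq[symmetric]
  by (rule e2ennreal_enn2ereal)

lemma ennreal_diff_add_eq: "(a - b) + b = a + (b - a)" for a b :: ennreal
proof (cases "a \<le> b")
  case True
  show ?thesis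
  proof (cases "a = top")
    case False
    with True have "a - b = 0" by (simp add: diff_eq_0_iff_ennreal less_top)
    with True show ?thesis by (simp add: add_diff_inverse_ennreal)
  qed simp
next
  case False
  then have "b \<le> a" "b - a = 0" by (auto simp: diff_eq_0_iff_ennreal not_le less_top[symmetric])
  then show ?thesis by (simp add: diff_add_cancel_ennreal)
qed

text \<open>
  \<open>A\<close> and \<open>B\<close> need not be the positive and negative parts of \<open>f\<close>. The parts are \<open>A - B\<close> and \<open>B - A\<close> with
  truncated subtraction, and \<open>(A - B) + B = A + (B - A)\<close>; finiteness of the integral of \<open>B\<close> allows
  its cancellation after integration.
\<close>

lemma ext_expectation_diff:
  assumes A [measurable]: "A \<in> borel_measurable M" and B [measurable]: "B \<in> borel_measurable M"
    and fin: "integral\<^sup>N M B < \<infinity>"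
    and f: "AE x in M. f x = enn2ereal (A x) - enn2ereal (B x)"
  shows "ext_expectation M f = enn2ereal (integral\<^sup>N M A) - enn2ereal (integral\<^sup>N M B)"
proof -
  have B_fin: "AE x in M. B x < \<infinity>" 
    using nn_integral_PInf_AE[OF B] fin by (auto simp: less_top)
  have pos: "(\<integral>\<^sup>+ x. e2ennreal (f x) \<partial>M) = (\<integral>\<^sup>+ x. A x - B x \<partial>M)"
  proof (rule nn_integral_cong_AE)
    show "AE x in M. e2ennreal (f x) = A x - B x"
      using f by eventually_elim (simp add: e2ennreal_diff)
  qed
  have neg: "(\<integral>\<^sup>+ x. e2ennreal (- f x) \<partial>M) = (\<integral>\<^sup>+ x. B x - A x \<partial>M)"
  proof (rule nn_integral_cong_AE)
    show "AE x in M. e2ennreal (- f x) = B x - A x"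
      using f B_fin
    proof eventually_elim
      case (elim x)
      then have "- f x = enn2ereal (B x) - enn2ereal (A x)"
        by (cases "A x"; cases "B x") auto
      then show ?case by (simp add: e2ennreal_diff)
    qed
  qed
  have "(\<integral>\<^sup>+ x. A x - B x \<partial>M) + integral\<^sup>N M B = (\<integral>\<^sup>+ x. (A x - B x) + B x \<partial>M)"
    by (rule nn_integral_add[symmetric]) measurable
  also have "\<dots> = (\<integral>\<^sup>+ x. A x + (B x - A x) \<partial>M)"
    by (simp add: ennreal_diff_add_eq)
  also have "\<dots> = integral\<^sup>N M A + (\<integral>\<^sup>+ x. B x - A x \<partial>M)"
    by (rule nn_integral_add) measurable
  finally have eq: "(\<integral>\<^sup>+ x. A x - B x \<partial>M) + integral\<^sup>N M B = integral\<^sup>N M A + (\<integral>\<^sup>+ x. B x - A x \<partial>M)" .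
  have le: "(\<integral>\<^sup>+ x. B x - A x \<partial>M) \<le> integral\<^sup>N M B"
    by (rule nn_integral_mono) (rule diff_le_self_ennreal)
  have alg: "enn2ereal p - enn2ereal q = enn2ereal a - enn2ereal b"
    if "p + b = a + q" "q \<le> b" "b < \<infinity>" for p q a b :: ennreal
  proof -
    obtain b' q' where b: "b = ennreal b'" "0 \<le> b'" and q: "q = ennreal q'" "0 \<le> q'"
      using \<open>q \<le> b\<close> \<open>b < \<infinity>\<close> by (cases b; cases q) (auto simp: top_unique)
    show ?thesis
    proof (cases "p = top \<or> a = top")
      case True
      then have "p = top \<and> a = top" using arg_cong[OF \<open>p + b = a + q\<close>, of "\<lambda>x. x = top"] b q by auto
      then show ?thesis using b q by simp
    next
      case False
      then obtain p' a' where p: "p = ennreal p'" "0 \<le> p'" and a: "a = ennreal a'" "0 \<le> a'"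
        by (cases p; cases a) auto
      have "ennreal (p' + b') = ennreal (a' + q')" using \<open>p + b = a + q\<close> p a b q by simp
      then have "p' + b' = a' + q'" using p a b q by (subst (asm) ennreal_inj) auto
      then show ?thesis using p a b q by (simp add: enn2ereal_ennreal)
    qed
  qed
  show ?thesis unfolding ext_expectation_def pos neg by (rule alg[OF eq le fin])
qed

lemma sum_enn2ereal_diff:
  assumes "finite I" "\<And>i. i \<in> I \<Longrightarrow> b i < \<infinity>"
  shows "(\<Sum>i\<in>I. enn2ereal (a i) - enn2ereal (b i)) = enn2ereal (\<Sum>i\<in>I. a i) - enn2ereal (\<Sum>i\<in>I. b i)"
  using assms
proof (induction I rule: finite_induct)
  case (insert j I)
  have alg: "(enn2ereal p - enn2ereal q) + (enn2ereal r - enn2ereal s) = enn2ereal (p + r) - enn2ereal (q + s)"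
    if fin: "q < \<infinity>" "s < \<infinity>" for p q r s :: ennreal
  proof -
    obtain q' s' where "enn2ereal q = ereal q'" "enn2ereal s = ereal s'"
      using fin by (cases q; cases s) (auto simp: enn2ereal_ennreal)
    then show ?thesis
      by (cases "enn2ereal p"; cases "enn2ereal r") (simp_all add: plus_ennreal.rep_eq)
  qed
  have "(\<Sum>i\<in>I. b i) < \<infinity>" using insert by (auto simp: less_top)
  then show ?case using insert by (simp add: alg)
qed simp

text \<open>
  Moving the subtracted terms across an inequality is possible once they are finite; this turns an
  inequality between integrals of parts into one between expectations.
\<close>

lemma enn2ereal_diff_le:
  assumes "p + t \<le> r + s + ennreal c" "s < \<infinity>" "t < \<infinity>" "0 \<le> c"
  shows "enn2ereal p - enn2ereal s \<le> enn2ereal r - enn2ereal t + ereal c"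
proof -
  obtain s' t' where s: "s = ennreal s'" "0 \<le> s'" and t: "t = ennreal t'" "0 \<le> t'"
    using assms by (cases s; cases t) auto
  show ?thesis
  proof (cases r)
    case top
    then show ?thesis using s t by simp
  next
    case (real r')
    have "r + s + ennreal c < \<top>" using real s by simp
    with assms(1) have "p + t < \<top>" by (rule le_less_trans)
    then obtain p' where p: "p = ennreal p'" "0 \<le> p'" by (cases p) auto
    have "ennreal (p' + t') \<le> ennreal (r' + s' + c)" using assms p s t real by simp
    then have "p' + t' \<le> r' + s' + c" using assms p s t real by (subst (asm) ennreal_le_iff) auto
    then show ?thesis using p s t real by (simp add: enn2ereal_ennreal)
  qed
qed

text \<open>
  The pointwise inequality behind the comparison of risks. For real-valued logarithms, it is the
  logarithm of \<open>le\<close>, with the negative parts moved to the other side so that every term is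
  nonnegative. In this form it also holds if some \<open>G i\<close> is \<open>0\<close>: then the right side is \<open>\<infinity>\<close>.
  Otherwise \<open>le\<close> forces every \<open>H i\<close> to be positive, and all logarithms are real.
\<close>

lemma sum_log_ratio_le:
  fixes F G H :: "'b \<Rightarrow> ennreal" and c :: real
  assumes I: "finite I" and c: "0 < c" "c \<le> 1"
    and F: "\<And>i. i \<in> I \<Longrightarrow> 0 < F i \<and> F i < \<infinity>"
    and G: "\<And>i. i \<in> I \<Longrightarrow> G i < \<infinity>" and H: "\<And>i. i \<in> I \<Longrightarrow> H i < \<infinity>"
    and le: "ennreal c * (\<Prod>i\<in>I. G i) \<le> (\<Prod>i\<in>I. H i)"
  shows "(\<Sum>i\<in>I. pos_log2 (F i / H i)) + (\<Sum>i\<in>I. neg_log2 (F i / G i)) \<le>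
    (\<Sum>i\<in>I. pos_log2 (F i / G i)) + (\<Sum>i\<in>I. neg_log2 (F i / H i)) + ennreal (- log 2 c)"
proof (cases "\<exists>i\<in>I. G i = 0")
  case True
  then obtain i where i: "i \<in> I" "G i = 0" by blast
  with F[OF i(1)] have "pos_log2 (F i / G i) = \<top>"
    by (simp add: ennreal_divide_zero pos_log2_top zero_less_iff_neq_zero)
  then have "(\<Sum>i\<in>I. pos_log2 (F i / G i)) = \<top>"
    using member_le_sum[OF i(1), of "\<lambda>i. pos_log2 (F i / G i)"] I by (simp add: top_unique)
  then show ?thesis by simp
next
  case False
  then have "ennreal c * (\<Prod>i\<in>I. G i) \<noteq> 0" using I c by (auto simp: ennreal_eq_0_iff)
  then have "(\<Prod>i\<in>I. H i) \<noteq> 0" using le by (metis le_zero_eq)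
  then have H0: "H i \<noteq> 0" if "i \<in> I" for i using that I by auto
  define f g h where "f i = enn2real (F i)" and "g i = enn2real (G i)" and "h i = enn2real (H i)" for i
  have f: "F i = ennreal (f i)" "0 < f i" if "i \<in> I" for i
    using F[OF that] by (auto simp: f_def enn2real_positive_iff)
  have g: "G i = ennreal (g i)" "0 < g i" if "i \<in> I" for i
    using G[OF that] False that by (auto simp: g_def enn2real_positive_iff zero_less_iff_neq_zero)
  have h: "H i = ennreal (h i)" "0 < h i" if "i \<in> I" for i
    using H[OF that] H0[OF that] by (auto simp: h_def enn2real_positive_iff zero_less_iff_neq_zero)
  let ?u = "\<lambda>i. log 2 (f i / g i)" and ?v = "\<lambda>i. log 2 (f i / h i)"
  have parts: "pos_log2 (F i / G i) = ennreal (max 0 (?u i))" "neg_log2 (F i / G i) = ennreal (max 0 (- ?u i))"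
    "pos_log2 (F i / H i) = ennreal (max 0 (?v i))" "neg_log2 (F i / H i) = ennreal (max 0 (- ?v i))"
    if "i \<in> I" for i
    using f[OF that] g[OF that] h[OF that]
    by (simp_all add: divide_ennreal pos_log2_ennreal neg_log2_ennreal max_def ennreal_neg)
  have sum_nonneg_parts: "(\<Sum>i\<in>I. k i) = ennreal (\<Sum>i\<in>I. max 0 (w i))"
    if k: "\<And>i. i \<in> I \<Longrightarrow> k i = ennreal (max 0 (w i))" for k and w :: "'b \<Rightarrow> real"
    by (subst sum_ennreal[symmetric], simp, rule sum.cong[OF refl k])
  have "ennreal (c * (\<Prod>i\<in>I. g i)) \<le> ennreal (\<Prod>i\<in>I. h i)"
    using le c g h by (simp add: ennreal_mult' prod_ennreal[symmetric] less_imp_le cong: prod.cong)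
  then have "c * (\<Prod>i\<in>I. g i) \<le> (\<Prod>i\<in>I. h i)"
    using h by (subst (asm) ennreal_le_iff) (auto intro!: prod_nonneg intro: less_imp_le)
  then have log_le: "log 2 (c * (\<Prod>i\<in>I. g i)) \<le> log 2 (\<Prod>i\<in>I. h i)"
    using c g h by (subst log_le_cancel_iff) (auto intro!: mult_pos_pos prod_pos)
  have log_prod: "log 2 (\<Prod>i\<in>I. w i) = (\<Sum>i\<in>I. log 2 (w i))"
    if "\<And>i. i \<in> I \<Longrightarrow> 0 < w i" for w :: "'b \<Rightarrow> real"
  proof -
    have "ln (\<Prod>i\<in>I. w i) = (\<Sum>i\<in>I. ln (w i))"
      by (rule ln_prod[OF I]) (use that in force)
    then show ?thesis by (simp add: log_def sum_divide_distrib)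
  qed
  have logs: "log 2 c + (\<Sum>i\<in>I. log 2 (g i)) \<le> (\<Sum>i\<in>I. log 2 (h i))"
  proof -
    have "0 < (\<Prod>i\<in>I. g i)" using g by (auto intro: prod_pos)
    then have "log 2 (c * (\<Prod>i\<in>I. g i)) = log 2 c + log 2 (\<Prod>i\<in>I. g i)"
      using c by (simp add: log_mult)
    with log_le log_prod[of g] log_prod[of h] g h show ?thesis by simp
  qed
  have "(\<Sum>i\<in>I. ?v i) \<le> (\<Sum>i\<in>I. ?u i) - log 2 c"
  proof -
    have "?v i = log 2 (f i) - log 2 (h i)" "?u i = log 2 (f i) - log 2 (g i)" if "i \<in> I" for i
      using f(2)[OF that] g(2)[OF that] h(2)[OF that] by (simp_all add: log_divide)
    then show ?thesis using logs by (simp add: sum_subtractf)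
  qed
  then have "(\<Sum>i\<in>I. max 0 (?v i)) + (\<Sum>i\<in>I. max 0 (- ?u i)) \<le>
      (\<Sum>i\<in>I. max 0 (?u i)) + (\<Sum>i\<in>I. max 0 (- ?v i)) + - log 2 c"
  proof -
    \<comment> \<open>The positive part is the number plus its negative part.\<close>
    have parts_sum: "(\<Sum>i\<in>I. max 0 (w i)) = (\<Sum>i\<in>I. w i) + (\<Sum>i\<in>I. max 0 (- w i))" for w :: "'b \<Rightarrow> real"
      unfolding sum.distrib[symmetric] by (rule sum.cong) (simp_all add: max_def)
    from parts_sum[of ?u] parts_sum[of ?v] show ?thesis
      using \<open>(\<Sum>i\<in>I. ?v i) \<le> (\<Sum>i\<in>I. ?u i) - log 2 c\<close> by linarith
  qed
  then have "ennreal ((\<Sum>i\<in>I. max 0 (?v i)) + (\<Sum>i\<in>I. max 0 (- ?u i))) \<le>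
      ennreal ((\<Sum>i\<in>I. max 0 (?u i)) + (\<Sum>i\<in>I. max 0 (- ?v i)) + - log 2 c)"
    by (rule ennreal_leI)
  moreover have "(\<Sum>i\<in>I. pos_log2 (F i / G i)) = ennreal (\<Sum>i\<in>I. max 0 (?u i))"
    "(\<Sum>i\<in>I. neg_log2 (F i / G i)) = ennreal (\<Sum>i\<in>I. max 0 (- ?u i))"
    "(\<Sum>i\<in>I. pos_log2 (F i / H i)) = ennreal (\<Sum>i\<in>I. max 0 (?v i))"
    "(\<Sum>i\<in>I. neg_log2 (F i / H i)) = ennreal (\<Sum>i\<in>I. max 0 (- ?v i))"
    by (rule sum_nonneg_parts, erule parts)+
  moreover have "0 \<le> (\<Sum>i\<in>I. max 0 (w i))" for w :: "'b \<Rightarrow> real" by (simp add: sum_nonneg)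
  moreover have "0 \<le> - log 2 c" using c by simp
  ultimately show ?thesis by (simp only: ennreal_plus add_nonneg_nonneg)
qed

section \<open>Base measures\<close>

text \<open>
  The generator consists of the finite intersections of basic open sets, cut down to \<open>X\<close>. Since it is
  closed under intersection, finite measures that agree on it are equal; since it is countable, an
  almost sure equality of measures can therefore be proved one set at a time.
\<close>

lemma restrict_borel_countable_generator:
  fixes X :: "'a::second_countable_topology set"
  obtains E where "countable E" "Int_stable E" "E \<subseteq> Pow X" "X \<in> E"
    "sets (restrict_space borel X) = sigma_sets X E"
proof -
  obtain B :: "'a set set" where B: "countable B" "topological_basis B"
    using ex_countable_basis by blast
  define I where "I = Inter ` {F. finite F \<and> F \<subseteq> B}"
  have I_countable: "countable I"
    unfolding I_def using B(1) by (intro countable_image countable_Collect_finite_subset)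
  have I_Int: "a \<inter> b \<in> I" if "a \<in> I" "b \<in> I" for a b
  proof -
    from that obtain F G where "finite F" "F \<subseteq> B" "finite G" "G \<subseteq> B" "a = \<Inter>F" "b = \<Inter>G"
      unfolding I_def by blast
    then have "a \<inter> b = \<Inter>(F \<union> G)" "finite (F \<union> G)" "F \<union> G \<subseteq> B" by auto
    then show ?thesis unfolding I_def by blast
  qed
  have I_open: "open a" if "a \<in> I" for a
    using that topological_basis_open[OF B(2)] unfolding I_def by (auto intro!: open_Inter)
  have "B \<subseteq> I"
  proof
    fix b assume "b \<in> B" then show "b \<in> I" 
      unfolding I_def by (intro image_eqI[of _ _ "{b}"]) auto
  qed
  have borel_I: "sets (borel :: 'a measure) = sigma_sets UNIV I"
  proof
    have "sets (borel :: 'a measure) = sigma_sets UNIV B"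
      by (simp add: borel_eq_countable_basis[OF B])
    also have "\<dots> \<subseteq> sigma_sets UNIV I" by (rule sigma_sets_subseteq) fact
    finally show "sets (borel :: 'a measure) \<subseteq> sigma_sets UNIV I" .
    show "sigma_sets UNIV I \<subseteq> sets (borel :: 'a measure)"
    proof -
      have "I \<subseteq> sets borel" using I_open by auto
      then show ?thesis using sets.sigma_sets_subset[of I borel] by simp
    qed
  qed
  show thesis
  proof
    show "countable ((\<inter>) X ` I)" using I_countable by simp
    show "Int_stable ((\<inter>) X ` I)"
    proof (rule Int_stableI)
      fix a b assume "a \<in> (\<inter>) X ` I" "b \<in> (\<inter>) X ` I"
      then obtain a' b' where "a' \<in> I" "b' \<in> I" "a \<inter> b = X \<inter> (a' \<inter> b')" by auto
      then show "a \<inter> b \<in> (\<inter>) X ` I" using I_Int by blast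
    qed
    show "(\<inter>) X ` I \<subseteq> Pow X" by auto
    have "UNIV \<in> I" unfolding I_def by (intro image_eqI[of _ _ "{}"]) auto
    then show "X \<in> (\<inter>) X ` I" by (rule rev_image_eqI) simp
    have "sets (restrict_space borel X) = (\<inter>) X ` sigma_sets UNIV I"
      by (simp add: sets_restrict_space borel_I)
    also have "\<dots> = sigma_sets X ((\<inter>) X ` I)"
      using sigma_sets_vimage_commute[of "\<lambda>x. x" X UNIV I]
      by (simp add: image_def Int_commute setcompr_eq_image)
    finally show "sets (restrict_space borel X) = sigma_sets X ((\<inter>) X ` I)" .
  qed
qed

lemma base_measure_sigma_finite:
  assumes "base_measure X \<mu>" shows "sigma_finite_measure \<mu>"
  using assms unfolding base_measure_def
  by (auto intro!: sigma_finite_measure_restrict_space sigma_finite_measure_count_space_countable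
      lborel.sigma_finite_measure_axioms)

lemma base_measure_sets:
  assumes "base_measure X \<mu>" shows "sets \<mu> = sets (restrict_space borel X)"
  using assms unfolding base_measure_def
proof (elim disjE conjE)
  assume X: "countable X" "\<mu> = count_space X"
  have "A \<in> (\<inter>) X ` sets borel" if "A \<subseteq> X" for A
    using that countable_subset[OF that X(1)] by (intro image_eqI[of _ _ A]) (auto intro: sets.countable)
  then show ?thesis using X(2) by (auto simp: sets_restrict_space)
next
  assume "\<mu> = restrict_space lborel X" 
  then show ?thesis by (simp add: sets_restrict_space)
qed

section \<open>The data law as a composition of kernels\<close>

locale data_source =
  fixes X :: "'a::euclidean_space set" and \<mu> :: "'a measure"
    and R :: "(nat \<Rightarrow> 'a) measure" and \<kappa> :: "nat \<Rightarrow> (nat \<Rightarrow> 'a) \<Rightarrow> 'a measure"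
  assumes base: "base_measure X \<mu>" and law: "data_law \<mu> R \<kappa>"
begin

sublocale R: prob_space R
  using law by (simp add: data_law_def)

sublocale \<mu>: sigma_finite_measure \<mu>
  by (rule base_measure_sigma_finite[OF base])

sublocale history: product_sigma_finite "\<lambda>_::nat. \<mu>" ..

abbreviation past :: "nat \<Rightarrow> (nat \<Rightarrow> 'a) \<Rightarrow> nat \<Rightarrow> 'a" where
  "past n \<omega> \<equiv> restrict \<omega> {..<n}"

lemma sets_R: "sets R = sets (PiM UNIV (\<lambda>_. \<mu>))"
  using law by (simp add: data_law_def)

lemma past_measurable [measurable]: "past n \<in> R \<rightarrow>\<^sub>M history_space \<mu> n"
  unfolding measurable_cong_sets[OF sets_R refl] by (rule measurable_restrict_subset) simp

lemma outcome_measurable [measurable]: "(\<lambda>\<omega>. \<omega> n) \<in> R \<rightarrow>\<^sub>M \<mu>"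
  unfolding measurable_cong_sets[OF sets_R refl] by (rule measurable_component_singleton) simp

lemma past_in_space: "\<omega> \<in> space R \<Longrightarrow> past n \<omega> \<in> space (history_space \<mu> n)"
  using past_measurable[of n] by (rule measurable_space)

lemma kernel_prob: "\<kappa> n \<in> history_space \<mu> n \<rightarrow>\<^sub>M prob_algebra \<mu>"
  using law by (simp add: data_law_def cond_distrs_def)

lemma kernel_subprob [measurable]: "\<kappa> n \<in> history_space \<mu> n \<rightarrow>\<^sub>M subprob_algebra \<mu>"
  using kernel_prob by (rule measurable_prob_algebraD)

lemma kernel_at:
  assumes "x \<in> space (history_space \<mu> n)"
  shows "sets (\<kappa> n x) = sets \<mu>" "prob_space (\<kappa> n x)"
  using measurable_space[OF kernel_prob assms] by (auto simp: space_prob_algebra)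

lemma Pair_measurable_kernel:
  assumes "x \<in> space (history_space \<mu> n)"
  shows "Pair x \<in> \<kappa> n x \<rightarrow>\<^sub>M history_space \<mu> n \<Otimes>\<^sub>M \<mu>"
  unfolding measurable_cong_sets[OF kernel_at(1)[OF assms] refl]
  by (rule measurable_Pair1'[OF assms])

lemma kernel_rectangle:
  assumes "A \<in> sets (history_space \<mu> n)" "B \<in> sets \<mu>"
  shows "emeasure R {\<omega>\<in>space R. past n \<omega> \<in> A \<and> \<omega> n \<in> B} =
    (\<integral>\<^sup>+ \<omega>. indicator A (past n \<omega>) * emeasure (\<kappa> n (past n \<omega>)) B \<partial>R)"
  using law assms by (simp add: data_law_def cond_distrs_def)

definition past_law :: "nat \<Rightarrow> (nat \<Rightarrow> 'a) measure" where
  "past_law n = distr R (history_space \<mu> n) (past n)"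

definition step_law :: "nat \<Rightarrow> ((nat \<Rightarrow> 'a) \<times> 'a) measure" where
  "step_law n = distr R (history_space \<mu> n \<Otimes>\<^sub>M \<mu>) (\<lambda>\<omega>. (past n \<omega>, \<omega> n))"

lemma sets_past_law [simp, measurable_cong]: "sets (past_law n) = sets (history_space \<mu> n)"
  by (simp add: past_law_def)

lemma space_past_law [simp]: "space (past_law n) = space (history_space \<mu> n)"
  by (simp add: past_law_def)

lemma sets_step_law [simp, measurable_cong]: "sets (step_law n) = sets (history_space \<mu> n \<Otimes>\<^sub>M \<mu>)"
  by (simp add: step_law_def)

lemma prob_space_past_law: "prob_space (past_law n)"
  unfolding past_law_def by (rule R.prob_space_distr) simp

lemma prob_space_step_law: "prob_space (step_law n)"
  unfolding step_law_def by (rule R.prob_space_distr) simp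

text \<open>
  The conditional distributions are specified by their values on rectangles, which generate the
  product \<open>\<sigma>\<close>-algebra and are closed under intersection. Hence the joint law of past and next outcome
  is the composition of the law of the past with the kernel.
\<close>

lemma step_law_bind:
  "step_law n = Giry_Monad.bind (past_law n) (\<lambda>x. distr (\<kappa> n x) (history_space \<mu> n \<Otimes>\<^sub>M \<mu>) (Pair x))"
  (is "_ = Giry_Monad.bind _ ?K")
proof -
  let ?H = "history_space \<mu> n"
  let ?E = "{a \<times> b | a b. a \<in> sets ?H \<and> b \<in> sets \<mu>}"
  interpret past: prob_space "past_law n" by (rule prob_space_past_law)
  interpret step: prob_space "step_law n" by (rule prob_space_step_law)
  have K [measurable]: "?K \<in> past_law n \<rightarrow>\<^sub>M subprob_algebra (?H \<Otimes>\<^sub>M \<mu>)"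
    by (rule measurable_distr2[where M = \<mu>]) measurable
  have sets_K: "sets (Giry_Monad.bind (past_law n) ?K) = sets (?H \<Otimes>\<^sub>M \<mu>)"
    by (rule sets_bind) (auto simp: past.not_empty[simplified])
  show ?thesis
  proof (rule measure_eqI_generator_eq[OF Int_stable_pair_measure_generator, of ?H \<mu> "space ?H \<times> space \<mu>"])
    show "?E \<subseteq> Pow (space ?H \<times> space \<mu>)" by (auto dest: sets.sets_into_space)
    show "sets (step_law n) = sigma_sets (space ?H \<times> space \<mu>) ?E"
      "sets (Giry_Monad.bind (past_law n) ?K) = sigma_sets (space ?H \<times> space \<mu>) ?E"
      by (simp_all add: sets_K sets_pair_measure)
    show "range (\<lambda>_. space ?H \<times> space \<mu>) \<subseteq> ?E" by auto
    show "emeasure (step_law n) (space ?H \<times> space \<mu>) \<noteq> \<infinity>" by simp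
    fix S assume "S \<in> ?E"
    then obtain A B where S: "S = A \<times> B" and [measurable]: "A \<in> sets ?H" "B \<in> sets \<mu>" by auto
    have "emeasure (step_law n) S = emeasure R {\<omega>\<in>space R. past n \<omega> \<in> A \<and> \<omega> n \<in> B}"
      unfolding step_law_def S
      by (subst emeasure_distr) (auto intro!: arg_cong[where f = "emeasure R"])
    also have "\<dots> = (\<integral>\<^sup>+ x. indicator A x * emeasure (\<kappa> n x) B \<partial>past_law n)"
      unfolding past_law_def by (subst nn_integral_distr) (auto simp: kernel_rectangle)
    also have "\<dots> = (\<integral>\<^sup>+ x. emeasure (?K x) S \<partial>past_law n)"
    proof (rule nn_integral_cong)
      fix x assume x: "x \<in> space (past_law n)"
      then have [measurable_cong]: "sets (\<kappa> n x) = sets \<mu>" by (simp add: kernel_at)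
      have "emeasure (?K x) S = emeasure (\<kappa> n x) (Pair x -` S \<inter> space (\<kappa> n x))"
        using x unfolding S by (subst emeasure_distr) (auto simp: Pair_measurable_kernel)
      also have "Pair x -` S \<inter> space (\<kappa> n x) = (if x \<in> A then B else {})"
        using sets.sets_into_space[of B \<mu>] sets_eq_imp_space_eq[OF \<open>sets (\<kappa> n x) = sets \<mu>\<close>]
        by (auto simp: S)
      finally show "indicator A x * emeasure (\<kappa> n x) B = emeasure (?K x) S" by simp
    qed
    also have "\<dots> = emeasure (Giry_Monad.bind (past_law n) ?K) S"
      by (rule emeasure_bind[OF past.not_empty K, symmetric]) (simp add: S)
    finally show "emeasure (step_law n) S = emeasure (Giry_Monad.bind (past_law n) ?K) S" .
  qed simp
qed

lemma nn_integral_disintegrate: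
  assumes g [measurable]: "g \<in> borel_measurable (history_space \<mu> n \<Otimes>\<^sub>M \<mu>)"
  shows "(\<integral>\<^sup>+ \<omega>. g (past n \<omega>, \<omega> n) \<partial>R) = (\<integral>\<^sup>+ \<omega>. (\<integral>\<^sup>+ y. g (past n \<omega>, y) \<partial>\<kappa> n (past n \<omega>)) \<partial>R)"
proof -
  let ?H = "history_space \<mu> n"
  have "(\<integral>\<^sup>+ \<omega>. g (past n \<omega>, \<omega> n) \<partial>R) = integral\<^sup>N (step_law n) g"
    unfolding step_law_def by (subst nn_integral_distr) auto
  also have "\<dots> = (\<integral>\<^sup>+ x. (\<integral>\<^sup>+ z. g z \<partial>distr (\<kappa> n x) (?H \<Otimes>\<^sub>M \<mu>) (Pair x)) \<partial>past_law n)"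
    unfolding step_law_bind
    by (rule nn_integral_bind[OF g], rule measurable_distr2[where M = \<mu>]) measurable
  also have "\<dots> = (\<integral>\<^sup>+ x. (\<integral>\<^sup>+ y. g (x, y) \<partial>\<kappa> n x) \<partial>past_law n)"
  proof (rule nn_integral_cong)
    fix x assume x: "x \<in> space (past_law n)"
    then have [measurable_cong]: "sets (\<kappa> n x) = sets \<mu>" by (simp add: kernel_at)
    show "(\<integral>\<^sup>+ z. g z \<partial>distr (\<kappa> n x) (?H \<Otimes>\<^sub>M \<mu>) (Pair x)) = (\<integral>\<^sup>+ y. g (x, y) \<partial>\<kappa> n x)"
      using x by (subst nn_integral_distr) (auto simp: Pair_measurable_kernel)
  qed
  also have "\<dots> = (\<integral>\<^sup>+ \<omega>. (\<integral>\<^sup>+ y. g (past n \<omega>, y) \<partial>\<kappa> n (past n \<omega>)) \<partial>R)"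
    unfolding past_law_def
    by (rule nn_integral_distr[OF past_measurable],
        rule nn_integral_measurable_subprob_algebra2[where N = \<mu>]) (simp_all add: split_beta')
  finally show ?thesis .
qed

lemma kernel_integral_measurable:
  assumes "g \<in> borel_measurable (history_space \<mu> n \<Otimes>\<^sub>M \<mu>)"
  shows "(\<lambda>\<omega>. \<integral>\<^sup>+ y. g (past n \<omega>, y) \<partial>\<kappa> n (past n \<omega>)) \<in> borel_measurable R"
proof -
  have "(\<lambda>x. \<integral>\<^sup>+ y. g (x, y) \<partial>\<kappa> n x) \<in> borel_measurable (history_space \<mu> n)"
    by (rule nn_integral_measurable_subprob_algebra2[where N = \<mu>]) (use assms in \<open>simp_all add: split_beta'\<close>)
  then show ?thesis by measurable
qed

lemma AE_disintegrate:
  assumes Q [measurable]: "Measurable.pred (history_space \<mu> n \<Otimes>\<^sub>M \<mu>) Q"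
    and ae: "AE \<omega> in R. AE y in \<kappa> n (past n \<omega>). Q (past n \<omega>, y)"
  shows "AE \<omega> in R. Q (past n \<omega>, \<omega> n)"
proof -
  let ?g = "\<lambda>z. indicator {z. \<not> Q z} z :: ennreal"
  have g: "?g \<in> borel_measurable (history_space \<mu> n \<Otimes>\<^sub>M \<mu>)" by measurable
  have "(\<integral>\<^sup>+ \<omega>. ?g (past n \<omega>, \<omega> n) \<partial>R) = (\<integral>\<^sup>+ \<omega>. (\<integral>\<^sup>+ y. ?g (past n \<omega>, y) \<partial>\<kappa> n (past n \<omega>)) \<partial>R)"
    by (rule nn_integral_disintegrate[OF g])
  also have "\<dots> = (\<integral>\<^sup>+ \<omega>. 0 \<partial>R)"
  proof (rule nn_integral_cong_AE)
    show "AE \<omega> in R. (\<integral>\<^sup>+ y. ?g (past n \<omega>, y) \<partial>\<kappa> n (past n \<omega>)) = 0"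
      using ae
    proof eventually_elim
      case (elim \<omega>)
      have "(\<integral>\<^sup>+ y. ?g (past n \<omega>, y) \<partial>\<kappa> n (past n \<omega>)) = (\<integral>\<^sup>+ y. 0 \<partial>\<kappa> n (past n \<omega>))"
        by (rule nn_integral_cong_AE) (use elim in \<open>eventually_elim, simp\<close>)
      then show ?case by simp
    qed
  qed
  finally have "(\<integral>\<^sup>+ \<omega>. ?g (past n \<omega>, \<omega> n) \<partial>R) = 0" by simp
  then have "AE \<omega> in R. ?g (past n \<omega>, \<omega> n) = 0"
    by (subst (asm) nn_integral_0_iff_AE) measurable
  then show ?thesis by eventually_elim (simp split: split_indicator_asm)
qed

lemma kernel_density: 
  "AE \<omega> in R. \<exists>f\<in>borel_measurable \<mu>. \<kappa> n (past n \<omega>) = density \<mu> f"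
  using law by (simp add: data_law_def)

text \<open>
  The quantifier over \<open>Q\<close> stands inside, since the exceptional null set consists of the pasts for
  which the kernel has no density and does not depend on \<open>Q\<close>. In applications, \<open>Q\<close> varies with the
  past.
\<close>

lemma AE_kernel:
  "AE \<omega> in R. \<forall>Q. (AE y in \<mu>. Q y) \<longrightarrow> (AE y in \<kappa> n (past n \<omega>). Q y)"
  using kernel_density[of n]
proof eventually_elim
  case (elim \<omega>)
  then obtain f where f: "f \<in> borel_measurable \<mu>" "\<kappa> n (past n \<omega>) = density \<mu> f" by blast
  show ?case unfolding f(2) by (auto simp: AE_density[OF f(1)] elim: eventually_mono)
qed

lemma past_Suc: "past (Suc n) \<omega> = (past n \<omega>)(n := \<omega> n)"
  by (auto simp: restrict_def)

lemma history_space_Suc: "history_space \<mu> (Suc n) = PiM (insert n {..<n}) (\<lambda>_. \<mu>)"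
  by (simp add: lessThan_Suc)

text \<open>
  The law of a history is absolutely continuous. By Fubini, the section of a null set at almost every
  shorter history is null for the base measure, hence null for the kernel, which has a density.
\<close>

lemma AE_history_null_set:
  assumes "N \<in> null_sets (history_space \<mu> n)"
  shows "AE \<omega> in R. past n \<omega> \<notin> N"
  using assms
proof (induction n arbitrary: N)
  case 0
  have "N = {}" if "N \<in> null_sets (PiM {} (\<lambda>_::nat. \<mu>))" for N
    using that by (auto simp: null_sets_def sets_PiM_empty)
  then have "N = {}" using 0 unfolding lessThan_0 by blast
  then show ?case by simp
next
  case (Suc n)
  let ?H = "history_space \<mu> n"
  have N [measurable]: "N \<in> sets (PiM (insert n {..<n}) (\<lambda>_. \<mu>))"
    using Suc.prems unfolding history_space_Suc by auto
  have upd: "(\<lambda>(x, y). x(n := y)) \<in> ?H \<Otimes>\<^sub>M \<mu> \<rightarrow>\<^sub>M PiM (insert n {..<n}) (\<lambda>_. \<mu>)"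
    by (rule measurable_add_dim)
  have [measurable]: "Measurable.pred (?H \<Otimes>\<^sub>M \<mu>) (\<lambda>z. (fst z)(n := snd z) \<notin> N)"
    using upd N by (auto simp: split_beta' intro!: pred_intros_logic pred_sets2[OF N])
  have sect: "(\<lambda>x. \<integral>\<^sup>+ y. indicator N (x(n := y)) \<partial>\<mu>) \<in> borel_measurable ?H"
    using upd by (intro \<mu>.borel_measurable_nn_integral) (simp add: split_beta')
  have "0 = (\<integral>\<^sup>+ x. indicator N x \<partial>PiM (insert n {..<n}) (\<lambda>_. \<mu>))"
    using Suc.prems N unfolding history_space_Suc by (simp add: null_sets_def)
  also have "\<dots> = (\<integral>\<^sup>+ x. (\<integral>\<^sup>+ y. indicator N (x(n := y)) \<partial>\<mu>) \<partial>?H)"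
    by (rule history.product_nn_integral_insert) auto
  finally have "AE x in ?H. (\<integral>\<^sup>+ y. indicator N (x(n := y)) \<partial>\<mu>) = 0"
    using sect by (subst (asm) eq_commute) (simp add: nn_integral_0_iff_AE)
  then obtain N' where N': "N' \<in> null_sets ?H"
      "{x\<in>space ?H. \<not> (\<integral>\<^sup>+ y. indicator N (x(n := y)) \<partial>\<mu>) = 0} \<subseteq> N'"
    by (auto simp: eventually_ae_filter)
  have avoid: "AE y in \<mu>. x(n := y) \<notin> N" if x: "x \<in> space ?H" "x \<notin> N'" for x
  proof -
    have [measurable]: "(\<lambda>y. x(n := y)) \<in> \<mu> \<rightarrow>\<^sub>M PiM (insert n {..<n}) (\<lambda>_. \<mu>)"
      using measurable_compose[OF measurable_Pair1'[OF x(1)] upd] by simp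
    have "(\<integral>\<^sup>+ y. indicator N (x(n := y)) \<partial>\<mu>) = 0"
      using x N'(2) by blast
    then show ?thesis
      by (subst (asm) nn_integral_0_iff_AE) (auto elim!: eventually_mono split: split_indicator_asm)
  qed
  have "AE \<omega> in R. AE y in \<kappa> n (past n \<omega>). (past n \<omega>)(n := y) \<notin> N"
    using Suc.IH[OF N'(1)] AE_kernel[of n] AE_space
    by eventually_elim (use avoid past_in_space in blast)
  then have "AE \<omega> in R. (past n \<omega>)(n := \<omega> n) \<notin> N"
    using AE_disintegrate[where n = n and Q = "\<lambda>z. (fst z)(n := snd z) \<notin> N"] by simp
  then show ?case unfolding past_Suc .
qed

lemma AE_history:
  assumes "AE x in history_space \<mu> n. Q x"
  shows "AE \<omega> in R. Q (past n \<omega>)"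
proof -
  obtain N where N: "N \<in> null_sets (history_space \<mu> n)" "{x\<in>space (history_space \<mu> n). \<not> Q x} \<subseteq> N"
    using assms by (auto simp: eventually_ae_filter)
  show ?thesis using AE_history_null_set[OF N(1)] AE_space
    by eventually_elim (use N(2) past_in_space in blast)
qed

section \<open>Jointly measurable conditional densities\<close>

text \<open>
  The version is the Radon-Nikodym derivative \<open>f\<close> of the joint law of past and next outcome with
  respect to the law of the past times \<open>\<mu>\<close>. For a fixed set \<open>B\<close> of outcomes, the kernel and the integral
  of \<open>f\<close> over \<open>B\<close> have the same integrals over all sets of pasts, so they agree for almost every past.
  A countable generator makes the exceptional null set independent of \<open>B\<close>.
\<close>

lemma conditional_density:
  obtains f where "f \<in> borel_measurable (history_space \<mu> n \<Otimes>\<^sub>M \<mu>)"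
    "AE \<omega> in R. \<kappa> n (past n \<omega>) = density \<mu> (\<lambda>y. f (past n \<omega>, y))"
proof -
  let ?H = "history_space \<mu> n" and ?S = "past_law n" and ?J = "step_law n"
  interpret S: prob_space ?S by (rule prob_space_past_law)
  interpret S\<mu>: pair_sigma_finite ?S \<mu> ..
  have sets_S\<mu>: "sets (?S \<Otimes>\<^sub>M \<mu>) = sets (?H \<Otimes>\<^sub>M \<mu>)"
    by (rule sets_pair_measure_cong) simp_all
  define f where "f = RN_deriv (?S \<Otimes>\<^sub>M \<mu>) ?J"
  have f_S: "f \<in> borel_measurable (?S \<Otimes>\<^sub>M \<mu>)" unfolding f_def by simp
  then have f [measurable]: "f \<in> borel_measurable (?H \<Otimes>\<^sub>M \<mu>)"
    by (simp add: measurable_cong_sets[OF sets_S\<mu> refl])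
  have "absolutely_continuous (?S \<Otimes>\<^sub>M \<mu>) ?J"
    unfolding absolutely_continuous_def
  proof
    fix N assume N: "N \<in> null_sets (?S \<Otimes>\<^sub>M \<mu>)"
    then have N_sets [measurable]: "N \<in> sets (?H \<Otimes>\<^sub>M \<mu>)" using sets_S\<mu> by blast
    have "AE z in ?S \<Otimes>\<^sub>M \<mu>. z \<notin> N" using N by (rule AE_not_in)
    then have "AE x in ?S. AE y in \<mu>. (x, y) \<notin> N" by (rule S\<mu>.AE_pair)
    then have "AE \<omega> in R. AE y in \<mu>. (past n \<omega>, y) \<notin> N"
      unfolding past_law_def by (rule AE_distrD[OF past_measurable])
    with AE_kernel[of n] have "AE \<omega> in R. AE y in \<kappa> n (past n \<omega>). (past n \<omega>, y) \<notin> N"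
      by eventually_elim blast
    then have "AE \<omega> in R. (past n \<omega>, \<omega> n) \<notin> N"
      by (intro AE_disintegrate) measurable
    then have "AE z in ?J. z \<notin> N"
      unfolding step_law_def by (subst AE_distr_iff) auto
    then show "N \<in> null_sets ?J"
      by (subst (asm) AE_iff_null_sets[symmetric]) simp_all
  qed
  then have J: "density (?S \<Otimes>\<^sub>M \<mu>) f = ?J"
    unfolding f_def by (rule S\<mu>.P.density_RN_deriv) (simp add: sets_S\<mu>)
  have f_section: "(\<lambda>y. f (x, y)) \<in> borel_measurable \<mu>" if "x \<in> space ?H" for x
    using f that by measurable
  \<comment> \<open>The exceptional null set still depends on \<open>B\<close> here.\<close>
  have kernel_eq: "AE x in ?S. emeasure (\<kappa> n x) B = emeasure (density \<mu> (\<lambda>y. f (x, y))) B"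
    if B [measurable]: "B \<in> sets \<mu>" for B
  proof -
    have "AE x in ?S. emeasure (\<kappa> n x) B = (\<integral>\<^sup>+ y. f (x, y) * indicator B y \<partial>\<mu>)"
    proof (rule S.density_unique_finite_measure)
      show "(\<lambda>x. emeasure (\<kappa> n x) B) \<in> borel_measurable ?S" by measurable
      show "(\<lambda>x. \<integral>\<^sup>+ y. f (x, y) * indicator B y \<partial>\<mu>) \<in> borel_measurable ?S" by measurable
      fix A assume "A \<in> sets ?S"
      then have A [measurable]: "A \<in> sets ?H" by simp
      have "(\<integral>\<^sup>+ x. emeasure (\<kappa> n x) B * indicator A x \<partial>?S) =
          emeasure R {\<omega>\<in>space R. past n \<omega> \<in> A \<and> \<omega> n \<in> B}"
        unfolding past_law_def
        by (subst nn_integral_distr) (auto simp: kernel_rectangle mult.commute)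
      also have "\<dots> = emeasure ?J (A \<times> B)"
        unfolding step_law_def by (subst emeasure_distr) (auto intro!: arg_cong[where f = "emeasure R"])
      also have "\<dots> = (\<integral>\<^sup>+ z. f z * indicator (A \<times> B) z \<partial>(?S \<Otimes>\<^sub>M \<mu>))"
        unfolding J[symmetric] using f_S by (subst emeasure_density) auto
      also have "\<dots> = (\<integral>\<^sup>+ x. (\<integral>\<^sup>+ y. f (x, y) * indicator (A \<times> B) (x, y) \<partial>\<mu>) \<partial>?S)"
        by (rule \<mu>.nn_integral_fst[symmetric]) measurable
      also have "\<dots> = (\<integral>\<^sup>+ x. (\<integral>\<^sup>+ y. f (x, y) * indicator B y \<partial>\<mu>) * indicator A x \<partial>?S)"
        by (rule nn_integral_cong) (auto simp: indicator_times split: split_indicator)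
      finally show "(\<integral>\<^sup>+ x. emeasure (\<kappa> n x) B * indicator A x \<partial>?S) =
          (\<integral>\<^sup>+ x. (\<integral>\<^sup>+ y. f (x, y) * indicator B y \<partial>\<mu>) * indicator A x \<partial>?S)" .
    qed simp_all
    then show ?thesis using AE_space
      by eventually_elim (simp add: emeasure_density f_section)
  qed
  obtain E where E: "countable E" "Int_stable E" "E \<subseteq> Pow X" "X \<in> E"
      "sets (restrict_space borel X) = sigma_sets X E"
    by (rule restrict_borel_countable_generator)
  have sets_\<mu>: "sets \<mu> = sigma_sets X E" using base_measure_sets[OF base] E(5) by simp
  have "AE x in ?S. \<forall>B\<in>E. emeasure (\<kappa> n x) B = emeasure (density \<mu> (\<lambda>y. f (x, y))) B"
    using E(1) by (subst AE_ball_countable) (auto simp: sets_\<mu> intro!: kernel_eq)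
  then have "AE x in ?S. \<kappa> n x = density \<mu> (\<lambda>y. f (x, y))"
    using AE_space
  proof eventually_elim
    case (elim x)
    then have x: "x \<in> space ?H" by simp
    interpret K: prob_space "\<kappa> n x" by (rule kernel_at(2)[OF x])
    show ?case
      by (rule measure_eqI_generator_eq[OF E(2,3), of _ _ "\<lambda>_. X"])
        (use elim(1) E(4) in \<open>auto simp: sets_\<mu> kernel_at(1)[OF x]\<close>)
  qed
  then have "AE \<omega> in R. \<kappa> n (past n \<omega>) = density \<mu> (\<lambda>y. f (past n \<omega>, y))"
    unfolding past_law_def by (rule AE_distrD[OF past_measurable])
  with f show thesis by (rule that)
qed

text \<open>
  One choice for all strategies, so that the terms of the data density cancel when risks are compared.
\<close>

definition cond_density :: "nat \<Rightarrow> (nat \<Rightarrow> 'a) \<times> 'a \<Rightarrow> ennreal" where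
  "cond_density n = (SOME f. f \<in> borel_measurable (history_space \<mu> n \<Otimes>\<^sub>M \<mu>) \<and>
     (AE \<omega> in R. \<kappa> n (past n \<omega>) = density \<mu> (\<lambda>y. f (past n \<omega>, y))))"

lemma cond_density_measurable [measurable]:
    "cond_density n \<in> borel_measurable (history_space \<mu> n \<Otimes>\<^sub>M \<mu>)"
  and kernel_eq_density: 
    "AE \<omega> in R. \<kappa> n (past n \<omega>) = density \<mu> (\<lambda>y. cond_density n (past n \<omega>, y))"
proof -
  have "\<exists>f. f \<in> borel_measurable (history_space \<mu> n \<Otimes>\<^sub>M \<mu>) \<and>
     (AE \<omega> in R. \<kappa> n (past n \<omega>) = density \<mu> (\<lambda>y. f (past n \<omega>, y)))"
    by (rule conditional_density[of n]) blast
  from someI_ex[OF this]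
  show "cond_density n \<in> borel_measurable (history_space \<mu> n \<Otimes>\<^sub>M \<mu>)"
    "AE \<omega> in R. \<kappa> n (past n \<omega>) = density \<mu> (\<lambda>y. cond_density n (past n \<omega>, y))"
    by (simp_all add: cond_density_def)
qed

section \<open>Risk as expected log-likelihood ratio\<close>

abbreviation ratio :: "'a strategy \<Rightarrow> nat \<Rightarrow> (nat \<Rightarrow> 'a) \<times> 'a \<Rightarrow> ennreal" where
  "ratio p n z \<equiv> cond_density n z / p n (fst z) (snd z)"

lemma strategy_measurable:
  assumes "prediction_strategy \<mu> p"
  shows "(\<lambda>z. p n (fst z) (snd z)) \<in> borel_measurable (history_space \<mu> n \<Otimes>\<^sub>M \<mu>)"
  using assms by (simp add: prediction_strategy_def split_beta')

lemma strategy_normalized: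
  assumes "prediction_strategy \<mu> p" "x \<in> space (history_space \<mu> n)"
  shows "(\<integral>\<^sup>+ y. p n x y \<partial>\<mu>) = 1"
  using assms by (simp add: prediction_strategy_def)

lemma ratio_measurable:
  assumes "prediction_strategy \<mu> p"
  shows "ratio p n \<in> borel_measurable (history_space \<mu> n \<Otimes>\<^sub>M \<mu>)"
  using strategy_measurable[OF assms, of n] by measurable

lemma section_measurable:
  assumes "x \<in> space (history_space \<mu> n)"
    and "g \<in> borel_measurable (history_space \<mu> n \<Otimes>\<^sub>M \<mu>)"
  shows "(\<lambda>y. g (x, y)) \<in> borel_measurable \<mu>"
  using assms by measurable

text \<open>
  The divergence is defined through arbitrary Radon-Nikodym derivatives, which may be replaced by
  the jointly measurable densities up to a null set of \<open>\<mu>\<close>, hence of the kernel.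
\<close>

lemma kl_div_eq_kernel_integrals:
  assumes p: "prediction_strategy \<mu> p" and x: "x \<in> space (history_space \<mu> n)"
    and K: "\<kappa> n x = density \<mu> (\<lambda>y. cond_density n (x, y))"
  shows "kl_div \<mu> (\<kappa> n x) (density \<mu> (p n x)) =
      enn2ereal (\<integral>\<^sup>+ y. pos_log2 (ratio p n (x, y)) \<partial>\<kappa> n x) -
      enn2ereal (\<integral>\<^sup>+ y. neg_log2 (ratio p n (x, y)) \<partial>\<kappa> n x)"
proof -
  have f: "(\<lambda>y. cond_density n (x, y)) \<in> borel_measurable \<mu>"
    by (rule section_measurable[OF x cond_density_measurable])
  have p_meas: "p n x \<in> borel_measurable \<mu>"
    using section_measurable[OF x strategy_measurable[OF p]] by simp
  have "AE y in \<mu>. RN_deriv \<mu> (\<kappa> n x) y / RN_deriv \<mu> (density \<mu> (p n x)) y = ratio p n (x, y)"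
    using \<mu>.RN_deriv_unique[OF f K[symmetric]] \<mu>.RN_deriv_unique[OF p_meas refl]
    by eventually_elim simp
  then have ae: "AE y in \<kappa> n x.
      RN_deriv \<mu> (\<kappa> n x) y / RN_deriv \<mu> (density \<mu> (p n x)) y = ratio p n (x, y)"
    by (subst K, subst AE_density[OF f]) (auto elim: eventually_mono)
  have "(\<integral>\<^sup>+ y. e2ennreal (log2_ennreal (RN_deriv \<mu> (\<kappa> n x) y / RN_deriv \<mu> (density \<mu> (p n x)) y)) \<partial>\<kappa> n x) =
      (\<integral>\<^sup>+ y. pos_log2 (ratio p n (x, y)) \<partial>\<kappa> n x)"
    by (rule nn_integral_cong_AE, rule eventually_mono[OF ae]) (simp add: pos_log2_def)
  moreover have "(\<integral>\<^sup>+ y. e2ennreal (- log2_ennreal (RN_deriv \<mu> (\<kappa> n x) y / RN_deriv \<mu> (density \<mu> (p n x)) y)) \<partial>\<kappa> n x) =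
      (\<integral>\<^sup>+ y. neg_log2 (ratio p n (x, y)) \<partial>\<kappa> n x)"
    by (rule nn_integral_cong_AE, rule eventually_mono[OF ae]) (simp add: neg_log2_def)
  ultimately show ?thesis by (simp only: kl_div_def ext_expectation_def)
qed

text \<open>
  With density \<open>f\<close> for the truth, \<open>E[(log (f / p))\<^sup>-] \<le> E[p / f] / ln 2 \<le> (\<integral> p d\<mu>) / ln 2 = 1 / ln 2\<close>.
\<close>

lemma kernel_integral_neg_log2_le:
  assumes p: "prediction_strategy \<mu> p" and x: "x \<in> space (history_space \<mu> n)"
    and K: "\<kappa> n x = density \<mu> (\<lambda>y. cond_density n (x, y))"
  shows "(\<integral>\<^sup>+ y. neg_log2 (ratio p n (x, y)) \<partial>\<kappa> n x) \<le> ennreal (1 / ln 2)"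
proof -
  have [measurable]: "(\<lambda>y. cond_density n (x, y)) \<in> borel_measurable \<mu>"
    by (rule section_measurable[OF x cond_density_measurable])
  have p_meas [measurable]: "p n x \<in> borel_measurable \<mu>"
    using section_measurable[OF x strategy_measurable[OF p]] by simp
  have "(\<integral>\<^sup>+ y. neg_log2 (ratio p n (x, y)) \<partial>\<kappa> n x) =
      (\<integral>\<^sup>+ y. cond_density n (x, y) * neg_log2 (ratio p n (x, y)) \<partial>\<mu>)"
    unfolding K by (rule nn_integral_density) simp_all
  also have "\<dots> \<le> (\<integral>\<^sup>+ y. ennreal (1 / ln 2) * p n x y \<partial>\<mu>)"
  proof (rule nn_integral_mono)
    fix y
    have "cond_density n (x, y) * neg_log2 (ratio p n (x, y)) \<le>
        cond_density n (x, y) * (ennreal (1 / ln 2) * inverse (ratio p n (x, y)))"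
      by (rule mult_left_mono[OF neg_log2_le_inverse]) simp
    also have "\<dots> = ennreal (1 / ln 2) *
        (cond_density n (x, y) * inverse (cond_density n (x, y) / p n x y))"
      by (simp add: mult_ac)
    also have "\<dots> \<le> ennreal (1 / ln 2) * p n x y"
      by (rule mult_left_mono[OF ennreal_mult_inverse_divide_le]) simp
    finally show "cond_density n (x, y) * neg_log2 (ratio p n (x, y)) \<le> ennreal (1 / ln 2) * p n x y" .
  qed
  also have "\<dots> = ennreal (1 / ln 2)"
    by (simp add: nn_integral_cmult strategy_normalized[OF p x])
  finally show ?thesis .
qed

text \<open>
  Both parts of the divergence at a given past are kernel integrals, so integrating over the past
  gives expectations over past and next outcome. The uniform bound on the negative part licenses
  this part by part, even if the risk is infinite.
\<close>

lemma
  assumes p: "prediction_strategy \<mu> p"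
  shows risk_eq_expected_log_ratio: "risk \<mu> R \<kappa> p (Suc n) =
      enn2ereal (\<integral>\<^sup>+ \<omega>. pos_log2 (ratio p n (past n \<omega>, \<omega> n)) \<partial>R) -
      enn2ereal (\<integral>\<^sup>+ \<omega>. neg_log2 (ratio p n (past n \<omega>, \<omega> n)) \<partial>R)"
    and neg_log2_ratio_integral_le:
      "(\<integral>\<^sup>+ \<omega>. neg_log2 (ratio p n (past n \<omega>, \<omega> n)) \<partial>R) \<le> ennreal (1 / ln 2)"
proof -
  let ?I = "\<lambda>h \<omega>. \<integral>\<^sup>+ y. h (ratio p n (past n \<omega>, y)) \<partial>\<kappa> n (past n \<omega>)"
  note [measurable] = ratio_measurable[OF p, of n]
  have meas: "(\<lambda>z. h (ratio p n z)) \<in> borel_measurable (history_space \<mu> n \<Otimes>\<^sub>M \<mu>)"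
    if "h \<in> borel_measurable borel" for h :: "ennreal \<Rightarrow> ennreal"
    using that by measurable
  note pos = meas[OF pos_log2_measurable] and neg = meas[OF neg_log2_measurable]
  have kl: "AE \<omega> in R. kl_div \<mu> (\<kappa> n (past n \<omega>)) (density \<mu> (p n (past n \<omega>))) =
      enn2ereal (?I pos_log2 \<omega>) - enn2ereal (?I neg_log2 \<omega>)"
    using kernel_eq_density[of n] AE_space
    by eventually_elim (rule kl_div_eq_kernel_integrals[OF p past_in_space])
  have "(\<integral>\<^sup>+ \<omega>. ?I neg_log2 \<omega> \<partial>R) \<le> (\<integral>\<^sup>+ \<omega>. ennreal (1 / ln 2) \<partial>R)"
    by (rule nn_integral_mono_AE, use kernel_eq_density[of n] AE_space in eventually_elim)
      (rule kernel_integral_neg_log2_le[OF p past_in_space])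
  then have le: "(\<integral>\<^sup>+ \<omega>. ?I neg_log2 \<omega> \<partial>R) \<le> ennreal (1 / ln 2)"
    by (simp add: R.emeasure_space_1)
  show "(\<integral>\<^sup>+ \<omega>. neg_log2 (ratio p n (past n \<omega>, \<omega> n)) \<partial>R) \<le> ennreal (1 / ln 2)"
    using le by (simp only: nn_integral_disintegrate[OF neg])
  show "risk \<mu> R \<kappa> p (Suc n) =
      enn2ereal (\<integral>\<^sup>+ \<omega>. pos_log2 (ratio p n (past n \<omega>, \<omega> n)) \<partial>R) -
      enn2ereal (\<integral>\<^sup>+ \<omega>. neg_log2 (ratio p n (past n \<omega>, \<omega> n)) \<partial>R)"
    unfolding nn_integral_disintegrate[OF pos] nn_integral_disintegrate[OF neg]
    unfolding risk_def Let_def diff_Suc_1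
    by (rule ext_expectation_diff[OF kernel_integral_measurable[OF pos]
          kernel_integral_measurable[OF neg] le_less_trans[OF le ennreal_less_top[folded infinity_ennreal_def]] kl])
qed

text \<open>
  A density may vanish on a large set, but the distribution that it defines gives this set
  probability zero.
\<close>

lemma AE_cond_density_pos_finite:
  "AE \<omega> in R. 0 < cond_density n (past n \<omega>, \<omega> n) \<and> cond_density n (past n \<omega>, \<omega> n) < \<infinity>"
proof (rule AE_disintegrate[where Q = "\<lambda>z. 0 < cond_density n z \<and> cond_density n z < \<infinity>"])
  show "AE \<omega> in R. AE y in \<kappa> n (past n \<omega>).
      0 < cond_density n (past n \<omega>, y) \<and> cond_density n (past n \<omega>, y) < \<infinity>"
    using kernel_eq_density[of n] AE_space
  proof eventually_elim
    case (elim \<omega>)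
    let ?f = "\<lambda>y. cond_density n (past n \<omega>, y)"
    note x = past_in_space[OF elim(2), of n]
    have f: "?f \<in> borel_measurable \<mu>"
      by (rule section_measurable[OF x cond_density_measurable])
    interpret K: prob_space "\<kappa> n (past n \<omega>)" by (rule kernel_at(2)[OF x])
    have "(\<integral>\<^sup>+ y. ?f y \<partial>\<mu>) = emeasure (\<kappa> n (past n \<omega>)) (space (\<kappa> n (past n \<omega>)))"
      unfolding elim(1) using f by (simp add: emeasure_density nn_integral_set_ennreal[symmetric] cong: nn_integral_cong)
    also have "\<dots> = 1" by (rule K.emeasure_space_1)
    finally have "AE y in \<mu>. ?f y \<noteq> \<infinity>" using f by (intro nn_integral_PInf_AE) auto
    then show ?case
      unfolding elim(1) AE_density[OF f] by (auto simp: less_top elim: eventually_mono)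
  qed
qed measurable

lemma AE_prediction_finite:
  assumes p: "prediction_strategy \<mu> p"
  shows "AE \<omega> in R. p n (past n \<omega>) (\<omega> n) < \<infinity>"
proof -
  note [measurable] = strategy_measurable[OF p, of n]
  have "AE \<omega> in R. AE y in \<kappa> n (past n \<omega>). p n (past n \<omega>) y < \<infinity>"
    using AE_kernel[of n] AE_space
  proof eventually_elim
    case (elim \<omega>)
    note x = past_in_space[OF elim(2), of n]
    have "p n (past n \<omega>) \<in> borel_measurable \<mu>"
      using section_measurable[OF x strategy_measurable[OF p]] by simp
    then have "AE y in \<mu>. p n (past n \<omega>) y \<noteq> \<infinity>"
      by (rule nn_integral_PInf_AE) (simp add: strategy_normalized[OF p x])
    then have "AE y in \<mu>. p n (past n \<omega>) y < \<infinity>" by (simp add: less_top)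
    with elim(1) show ?case by blast
  qed
  then show ?thesis
    using AE_disintegrate[where n = n and Q = "\<lambda>z. p n (fst z) (snd z) < \<infinity>"] by simp
qed

section \<open>Comparison of summed risks\<close>

text \<open>
  In single steps \<open>p\<close> may predict much worse than \<open>q\<close>. Summed along a sequence, the log-ratios of the
  predictions depend only on the joint densities, where the domination applies. It suffices almost
  everywhere for the base measure because the law of a history is absolutely continuous.
\<close>

lemma sum_risk_le:
  fixes c :: real
  assumes p: "prediction_strategy \<mu> p" and q: "prediction_strategy \<mu> q"
    and c: "0 < c" "c \<le> 1"
    and dom: "AE x in history_space \<mu> n. ennreal c * joint q n x \<le> joint p n x"
  shows "(\<Sum>i=1..n. risk \<mu> R \<kappa> p i) \<le> (\<Sum>i=1..n. risk \<mu> R \<kappa> q i) - ereal (log 2 c)"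
proof -
  define pos where "pos s i \<omega> = pos_log2 (ratio s i (past i \<omega>, \<omega> i))" for s i \<omega>
  define neg where "neg s i \<omega> = neg_log2 (ratio s i (past i \<omega>, \<omega> i))" for s i \<omega>
  have meas: "pos s i \<in> borel_measurable R" "neg s i \<in> borel_measurable R"
    if "prediction_strategy \<mu> s" for s i
  proof -
    have "(\<lambda>\<omega>. (past i \<omega>, \<omega> i)) \<in> R \<rightarrow>\<^sub>M history_space \<mu> i \<Otimes>\<^sub>M \<mu>" by measurable
    from measurable_compose[OF this ratio_measurable[OF that, of i]]
    have [measurable]: "(\<lambda>\<omega>. ratio s i (past i \<omega>, \<omega> i)) \<in> borel_measurable R" .
    show "pos s i \<in> borel_measurable R" "neg s i \<in> borel_measurable R"
      unfolding pos_def neg_def by measurable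
  qed
  note [measurable] = meas[OF p] meas[OF q]
  have neg_finite: "(\<integral>\<^sup>+ \<omega>. neg s i \<omega> \<partial>R) < \<infinity>" if "prediction_strategy \<mu> s" for s i
    using neg_log2_ratio_integral_le[OF that, of i] unfolding neg_def
    by (rule le_less_trans) simp
  have sum_risk: "(\<Sum>i=1..n. risk \<mu> R \<kappa> s i) =
      enn2ereal (\<integral>\<^sup>+ \<omega>. (\<Sum>i<n. pos s i \<omega>) \<partial>R) - enn2ereal (\<integral>\<^sup>+ \<omega>. (\<Sum>i<n. neg s i \<omega>) \<partial>R)"
    if s: "prediction_strategy \<mu> s" for s
  proof -
    have "(\<Sum>i=1..n. risk \<mu> R \<kappa> s i) = (\<Sum>i<n. risk \<mu> R \<kappa> s (Suc i))"
      by (rule sum.reindex_bij_witness[of _ Suc "\<lambda>i. i - 1"]) auto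
    also have "\<dots> = (\<Sum>i<n. enn2ereal (\<integral>\<^sup>+ \<omega>. pos s i \<omega> \<partial>R) - enn2ereal (\<integral>\<^sup>+ \<omega>. neg s i \<omega> \<partial>R))"
      unfolding pos_def neg_def by (simp add: risk_eq_expected_log_ratio[OF s])
    also have "\<dots> = enn2ereal (\<Sum>i<n. \<integral>\<^sup>+ \<omega>. pos s i \<omega> \<partial>R) - enn2ereal (\<Sum>i<n. \<integral>\<^sup>+ \<omega>. neg s i \<omega> \<partial>R)"
      by (rule sum_enn2ereal_diff[OF finite_lessThan neg_finite[OF s]])
    finally show ?thesis by (simp add: nn_integral_sum meas[OF s])
  qed
  \<comment> \<open>A shorter past is a restriction of a longer one, so the factors of the joint density are predictions from pasts of \<open>\<omega>\<close>.\<close>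
  have joint_past: "joint s n (past n \<omega>) = (\<Prod>i<n. s i (past i \<omega>) (\<omega> i))" for s \<omega>
    unfolding joint_def by (rule prod.cong) (auto simp: Int_absorb1)
  have all_F: "AE \<omega> in R. \<forall>i\<in>{..<n}. 0 < cond_density i (past i \<omega>, \<omega> i) \<and> cond_density i (past i \<omega>, \<omega> i) < \<infinity>"
    by (intro AE_finite_allI AE_cond_density_pos_finite) simp
  have all_G: "AE \<omega> in R. \<forall>i\<in>{..<n}. q i (past i \<omega>) (\<omega> i) < \<infinity>"
    by (intro AE_finite_allI AE_prediction_finite[OF q]) simp
  have all_H: "AE \<omega> in R. \<forall>i\<in>{..<n}. p i (past i \<omega>) (\<omega> i) < \<infinity>"
    by (intro AE_finite_allI AE_prediction_finite[OF p]) simp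
  have "AE \<omega> in R. (\<Sum>i<n. pos p i \<omega>) + (\<Sum>i<n. neg q i \<omega>) \<le>
      (\<Sum>i<n. pos q i \<omega>) + (\<Sum>i<n. neg p i \<omega>) + ennreal (- log 2 c)"
    using AE_history[OF dom] all_F all_G all_H
  proof eventually_elim
    case (elim \<omega>)
    show ?case
      unfolding pos_def neg_def fst_conv snd_conv
      by (rule sum_log_ratio_le) (use elim c in \<open>auto simp: joint_past\<close>)
  qed
  then have "(\<integral>\<^sup>+ \<omega>. (\<Sum>i<n. pos p i \<omega>) + (\<Sum>i<n. neg q i \<omega>) \<partial>R) \<le>
      (\<integral>\<^sup>+ \<omega>. (\<Sum>i<n. pos q i \<omega>) + (\<Sum>i<n. neg p i \<omega>) + ennreal (- log 2 c) \<partial>R)"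
    by (rule nn_integral_mono_AE)
  then have "(\<integral>\<^sup>+ \<omega>. (\<Sum>i<n. pos p i \<omega>) \<partial>R) + (\<integral>\<^sup>+ \<omega>. (\<Sum>i<n. neg q i \<omega>) \<partial>R) \<le>
      (\<integral>\<^sup>+ \<omega>. (\<Sum>i<n. pos q i \<omega>) \<partial>R) + (\<integral>\<^sup>+ \<omega>. (\<Sum>i<n. neg p i \<omega>) \<partial>R) + ennreal (- log 2 c)"
    by (simp add: nn_integral_add R.emeasure_space_1)
  moreover have "(\<integral>\<^sup>+ \<omega>. (\<Sum>i<n. neg s i \<omega>) \<partial>R) < \<infinity>" if "prediction_strategy \<mu> s" for s
    using neg_finite[OF that] by (simp add: nn_integral_sum meas[OF that] less_top)
  ultimately show ?thesis
    unfolding sum_risk[OF p] sum_risk[OF q]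
    using enn2ereal_diff_le[where c = "- log 2 c"] p q c by (simp add: minus_ereal_def)
qed

end

theorem lemma3:
  fixes X :: "'a::euclidean_space set" and \<mu> :: "'a measure"
    and \<nu> :: "nat \<Rightarrow> 'c measure" and w :: "nat \<Rightarrow> 'c \<Rightarrow> ennreal"
    and P :: "nat \<Rightarrow> 'c \<Rightarrow> 'a strategy" and pb :: "nat \<Rightarrow> 'a strategy"
    and \<pi>M \<pi>K \<pi>T :: "nat pmf"
  assumes "base_measure X \<mu>"
    and "\<And>k. 1 \<le> k \<Longrightarrow> bayesian_predictive \<mu> (\<nu> k) (w k) (P k) (pb k)"
    and "set_pmf \<pi>M = {1..}" and "set_pmf \<pi>K = {1..}" and "set_pmf \<pi>T = {1..}"
  shows
    "(\<forall>n\<ge>1. \<forall>x\<in>{..<n} \<rightarrow>\<^sub>E X. \<forall>k\<ge>1.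
        switch_density (switch_prior \<pi>M \<pi>K \<pi>T) pb n x \<ge> ennreal (pmf \<pi>M 1) * bma_density \<pi>K pb n x \<and>
        ennreal (pmf \<pi>M 1) * bma_density \<pi>K pb n x
          \<ge> ennreal (pmf \<pi>M 1) * ennreal (pmf \<pi>K k) * joint (pb k) n x) \<and>
     (\<forall>psw pbma R \<kappa>.
        has_joint_density \<mu> psw (switch_density (switch_prior \<pi>M \<pi>K \<pi>T) pb) \<longrightarrow>
        has_joint_density \<mu> pbma (bma_density \<pi>K pb) \<longrightarrow>
        data_law \<mu> R \<kappa> \<longrightarrow>
        (\<forall>n\<ge>1. \<forall>k\<ge>1.
           (\<Sum>i=1..n. risk \<mu> R \<kappa> psw i)
             \<le> (\<Sum>i=1..n. risk \<mu> R \<kappa> pbma i) - ereal (log 2 (pmf \<pi>M 1)) \<and>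
           (\<Sum>i=1..n. risk \<mu> R \<kappa> pbma i) - ereal (log 2 (pmf \<pi>M 1))
             \<le> (\<Sum>i=1..n. risk \<mu> R \<kappa> (pb k) i)
                 - ereal (log 2 (pmf \<pi>M 1)) - ereal (log 2 (pmf \<pi>K k))))"
proof -
  let ?sw = "switch_density (switch_prior \<pi>M \<pi>K \<pi>T) pb" and ?bma = "bma_density \<pi>K pb"
  have pos: "0 < pmf \<pi>M 1" "0 < pmf \<pi>K k" if "1 \<le> k" for k
    using assms(3,4) that by (simp_all add: pmf_positive)
  have densities: "ennreal (pmf \<pi>M 1) * ennreal (pmf \<pi>K k) * joint (pb k) n x \<le> ennreal (pmf \<pi>M 1) * ?bma n x"
    if "1 \<le> k" for n x k
    using mult_left_mono[OF bma_density_ge_component[OF that]] by (simp add: mult.assoc)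
  have risks: "(\<Sum>i=1..n. risk \<mu> R \<kappa> psw i) \<le> (\<Sum>i=1..n. risk \<mu> R \<kappa> pbma i) - ereal (log 2 (pmf \<pi>M 1)) \<and>
      (\<Sum>i=1..n. risk \<mu> R \<kappa> pbma i) - ereal (log 2 (pmf \<pi>M 1)) \<le>
      (\<Sum>i=1..n. risk \<mu> R \<kappa> (pb k) i) - ereal (log 2 (pmf \<pi>M 1)) - ereal (log 2 (pmf \<pi>K k))"
    if sw: "has_joint_density \<mu> psw ?sw" and bma: "has_joint_density \<mu> pbma ?bma"
      and law: "data_law \<mu> R \<kappa>" and k: "1 \<le> k" for psw pbma R \<kappa> n k
  proof -
    interpret data_source X \<mu> R \<kappa> by unfold_locales (fact assms(1), fact law)
    have psw: "prediction_strategy \<mu> psw" and pbma: "prediction_strategy \<mu> pbma"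
      using sw bma by (simp_all add: has_joint_density_def)
    have pb: "prediction_strategy \<mu> (pb k)"
      using assms(2)[OF k] by (simp add: bayesian_predictive_def has_joint_density_def)
    have sw_eq: "AE x in history_space \<mu> n. joint psw n x = ?sw n x"
      and bma_eq: "AE x in history_space \<mu> n. joint pbma n x = ?bma n x"
      using sw bma by (simp_all add: has_joint_density_def)
    have "AE x in history_space \<mu> n. ennreal (pmf \<pi>M 1) * joint pbma n x \<le> joint psw n x"
      using sw_eq bma_eq by eventually_elim (simp only: switch_density_ge_bma)
    then have "(\<Sum>i=1..n. risk \<mu> R \<kappa> psw i) \<le> (\<Sum>i=1..n. risk \<mu> R \<kappa> pbma i) - ereal (log 2 (pmf \<pi>M 1))"
      by (rule sum_risk_le[OF psw pbma pos(1)[OF k] pmf_le_1])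
    moreover have "AE x in history_space \<mu> n. ennreal (pmf \<pi>K k) * joint (pb k) n x \<le> joint pbma n x"
      using bma_eq by eventually_elim (simp add: bma_density_ge_component[OF k])
    then have "(\<Sum>i=1..n. risk \<mu> R \<kappa> pbma i) \<le> (\<Sum>i=1..n. risk \<mu> R \<kappa> (pb k) i) - ereal (log 2 (pmf \<pi>K k))"
      by (rule sum_risk_le[OF pbma pb pos(2)[OF k] pmf_le_1])
    then have "(\<Sum>i=1..n. risk \<mu> R \<kappa> pbma i) - ereal (log 2 (pmf \<pi>M 1)) \<le>
        (\<Sum>i=1..n. risk \<mu> R \<kappa> (pb k) i) - ereal (log 2 (pmf \<pi>M 1)) - ereal (log 2 (pmf \<pi>K k))"
      by (cases "\<Sum>i=1..n. risk \<mu> R \<kappa> pbma i"; cases "\<Sum>i=1..n. risk \<mu> R \<kappa> (pb k) i") simp_all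
    ultimately show ?thesis by blast
  qed
  show ?thesis
    using switch_density_ge_bma densities risks by blast
qed

end
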